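(* Let $S\subseteq\mathbb R^n$ be a set and define $S'=\{(a,s)\in\mathbb R^{n+1} : a\in S,\ \|a\|\ge1,\ \|a\|^2s^2\le1\}$. Then $\mathcal B(S)\cong\mathcal B_0(S')$ via the identification $p\in\mathcal B_d(S)\leftrightarrow p\cdot t^d$, where $t$ is the last coordinate function on $\mathbb R^{n+1}$; that is, $\mathcal B(S)$, viewed as a subalgebra of $\mathbb R[x_1,\dots,x_n,t]$, equals $\mathcal B_0(S')$.
   Context: For $T\subseteq\mathbb R^m$ and $d\in\mathbb N=\{0,1,\dots\}$, $\mathcal B_d(T)$ is the set of polynomials $p$ in $m$ variables over $\mathbb R$ for which there is a polynomial $q$ of total degree at most $2d$ with $p^2\le q$ on $T$; in particular $\mathcal B_0(T)$ is the algebra of polynomials bounded on $T$. $\mathcal B(T)=\bigoplus_{d\ge0}\mathcal B_d(T)$ is a graded algebra. $\|\cdot\|$ is the Euclidean norm. *)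

theory Defs
  imports "HOL-Analysis.Analysis" "HOL-Library.Poly_Mapping"
begin

text \<open>
  Polynomials are finitely supported maps from exponent vectors to coefficients, with the
  convolution product of \<^theory>\<open>HOL-Library.Poly_Mapping\<close>. The variables are
  indexed by the natural numbers; \<^term>\<open>m\<close>-variable polynomials are those that only use
  the variables with index below \<^term>\<open>m\<close>. Correspondingly, the space of real
  \<^term>\<open>m\<close>-tuples is the library's \<open>topspace (Euclidean_space m)\<close>, that is, the
  sequences that vanish from index \<^term>\<open>m\<close> on. With this encoding a polynomial in
  \<^term>\<open>n\<close> variables is literally also one in \<open>n + 1\<close> variables.
\<close>

type_synonym mpoly = "(nat \<Rightarrow>\<^sub>0 nat) \<Rightarrow>\<^sub>0 real"

definition mpoly_const :: "real \<Rightarrow> mpoly" where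
  "mpoly_const c = Poly_Mapping.single 0 c"

definition mpoly_var :: "nat \<Rightarrow> mpoly" where
  "mpoly_var i = Poly_Mapping.single (Poly_Mapping.single i 1) 1"

definition mpolys :: "nat \<Rightarrow> mpoly set" where
  "mpolys m = {p. \<forall>u\<in>Poly_Mapping.keys p. Poly_Mapping.keys u \<subseteq> {..<m}}"

definition mpoly_eval :: "mpoly \<Rightarrow> (nat \<Rightarrow> real) \<Rightarrow> real" where
  "mpoly_eval p a = (\<Sum>u\<in>Poly_Mapping.keys p.
     Poly_Mapping.lookup p u * (\<Prod>i\<in>Poly_Mapping.keys u. a i ^ Poly_Mapping.lookup u i))"

text \<open>The zero polynomial gets total degree 0 here, which is harmless because the degree
  only occurs in upper bounds.\<close>

definition total_degree :: "mpoly \<Rightarrow> nat" where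
  "total_degree p = Max (insert 0
     ((\<lambda>u. \<Sum>i\<in>Poly_Mapping.keys u. Poly_Mapping.lookup u i) ` Poly_Mapping.keys p))"

text \<open>The space \<open>\<B>\<^sub>d(T)\<close> for a set \<open>T\<close> of real \<open>m\<close>-tuples.\<close>

definition bdd_polys :: "nat \<Rightarrow> nat \<Rightarrow> (nat \<Rightarrow> real) set \<Rightarrow> mpoly set" where
  "bdd_polys m d T = {p \<in> mpolys m. \<exists>q\<in>mpolys m. total_degree q \<le> 2 * d \<and>
     (\<forall>a\<in>T. (mpoly_eval p a)\<^sup>2 \<le> mpoly_eval q a)}"

text \<open>The external direct sum \<open>\<B>(T)\<close>: finitely supported families whose entry of index
  \<open>d\<close> lies in \<open>\<B>\<^sub>d(T)\<close>. The convolution product on \<^typ>\<open>nat \<Rightarrow>\<^sub>0 mpoly\<close> is the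
  graded multiplication; \<open>Poly_Mapping.single d p\<close> is \<open>p\<close> as a homogeneous element of
  degree \<open>d\<close>.\<close>

definition graded_bdd_polys :: "nat \<Rightarrow> (nat \<Rightarrow> real) set \<Rightarrow> (nat \<Rightarrow>\<^sub>0 mpoly) set" where
  "graded_bdd_polys m T = {f. \<forall>d. Poly_Mapping.lookup f d \<in> bdd_polys m d T}"

definition graded_const :: "real \<Rightarrow> (nat \<Rightarrow>\<^sub>0 mpoly)" where
  "graded_const c = Poly_Mapping.single 0 (mpoly_const c)"

text \<open>The set \<open>S'\<close>; a point \<open>(a, s)\<close> is \<open>a\<close> with its coordinate of index \<open>n\<close> set to
  \<open>s\<close>.\<close>

definition cusp_set :: "nat \<Rightarrow> (nat \<Rightarrow> real) set \<Rightarrow> (nat \<Rightarrow> real) set" where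
  "cusp_set n S = {a(n := s) | a s. a \<in> S \<and> L2_set a {..<n} \<ge> 1 \<and>
     (L2_set a {..<n})\<^sup>2 * s\<^sup>2 \<le> 1}"

text \<open>The variable \<open>t\<close> is \<^term>\<open>mpoly_var n\<close>.\<close>

definition identification :: "nat \<Rightarrow> (nat \<Rightarrow>\<^sub>0 mpoly) \<Rightarrow> mpoly" where
  "identification n f =
     (\<Sum>d\<in>Poly_Mapping.keys f. Poly_Mapping.lookup f d * mpoly_var n ^ d)"

text \<open>Real algebras are given by their structure maps from the reals, so that scalar
  multiplication by \<open>c\<close> is multiplication by \<open>\<eta> c\<close>. Closure under negation and the
  unit comes from \<open>\<eta> (-1)\<close> and \<open>\<eta> 1\<close>.\<close>

definition real_subalgebra :: "(real \<Rightarrow> 'a::comm_ring_1) \<Rightarrow> 'a set \<Rightarrow> bool" where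
  "real_subalgebra \<eta> A \<longleftrightarrow>
     range \<eta> \<subseteq> A \<and> (\<forall>x\<in>A. \<forall>y\<in>A. x + y \<in> A \<and> x * y \<in> A)"

definition real_algebra_iso ::
  "(real \<Rightarrow> 'a::comm_ring_1) \<Rightarrow> 'a set \<Rightarrow>
   (real \<Rightarrow> 'b::comm_ring_1) \<Rightarrow> 'b set \<Rightarrow> ('a \<Rightarrow> 'b) \<Rightarrow> bool" where
  "real_algebra_iso \<eta> A \<theta> B h \<longleftrightarrow>
     real_subalgebra \<eta> A \<and> real_subalgebra \<theta> B \<and> bij_betw h A B \<and>
     (\<forall>c. h (\<eta> c) = \<theta> c) \<and>
     (\<forall>x\<in>A. \<forall>y\<in>A. h (x + y) = h x + h y \<and> h (x * y) = h x * h y)"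

end

theory Submission
  imports Defs
begin

text \<open>
  On the set \<open>S'\<close> the last coordinate satisfies \<open>\<bar>s\<bar> \<le> 1 / \<parallel>a\<parallel>\<close> and \<open>\<parallel>a\<parallel> \<ge> 1\<close>, so
  \<open>p\<^sup>2 \<le> q\<close> with \<open>deg q \<le> 2d\<close> makes \<open>p t\<^sup>d\<close> bounded there. Conversely, let
  \<open>\<Sum>\<^sub>d p\<^sub>d t\<^sup>d\<close> be bounded on \<open>S'\<close>. For fixed \<open>a\<close>, substituting \<open>s = v / \<parallel>a\<parallel>\<close>
  gives a univariate polynomial in \<open>v\<close> that is bounded on \<open>[-1, 1]\<close>, uniformly in \<open>a\<close>. As the
  coefficients of a polynomial of bounded degree are controlled by its supremum on \<open>[-1, 1]\<close>,
  \<open>\<bar>p\<^sub>d(a)\<bar> \<le> C \<parallel>a\<parallel>\<^sup>d\<close> for \<open>\<parallel>a\<parallel> \<ge> 1\<close>, while \<open>p\<^sub>d\<close> is bounded on the unit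
  ball. Hence \<open>p\<^sub>d\<^sup>2 \<le> A (\<Sum>\<^sub>i x\<^sub>i\<^sup>2)\<^sup>d + B\<close> on \<open>S\<close>.
\<close>

section \<open>Evaluation of finitely supported maps\<close>

text \<open>Both \<^const>\<open>mpoly_eval\<close> and \<^const>\<open>identification\<close> are instances of the following map.\<close>

definition eval_along :: "('k \<Rightarrow> 'b) \<Rightarrow> ('k::comm_monoid_add \<Rightarrow>\<^sub>0 'b::comm_ring_1) \<Rightarrow> 'b" where
  "eval_along \<phi> f = (\<Sum>k\<in>Poly_Mapping.keys f. Poly_Mapping.lookup f k * \<phi> k)"

lemma eval_along_zero [simp]: "eval_along \<phi> 0 = 0"
  by (simp add: eval_along_def)

lemma eval_along_add: "eval_along \<phi> (f + g) = eval_along \<phi> f + eval_along \<phi> g"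
  unfolding eval_along_def
  by (rule setsum_keys_plus_distrib) (simp_all add: algebra_simps)

lemma eval_along_sum: "eval_along \<phi> (sum F A) = (\<Sum>x\<in>A. eval_along \<phi> (F x))"
  by (induction A rule: infinite_finite_induct) (simp_all add: eval_along_add)

lemma eval_along_single [simp]: "eval_along \<phi> (Poly_Mapping.single k v) = v * \<phi> k"
  by (simp add: eval_along_def)

lemma poly_mapping_eq_sum_single:
  "f = (\<Sum>k\<in>Poly_Mapping.keys f. Poly_Mapping.single k (Poly_Mapping.lookup f k))"
proof (rule poly_mapping_eqI)
  fix j
  show "Poly_Mapping.lookup f j =
    Poly_Mapping.lookup (\<Sum>k\<in>Poly_Mapping.keys f. Poly_Mapping.single k (Poly_Mapping.lookup f k)) j"
    by (simp add: lookup_sum lookup_single when_def in_keys_iff)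
qed

text \<open>Expanding both factors into single terms turns the convolution into a finite double sum,
  so evaluation, lookup and membership can be treated termwise.\<close>

lemma mult_eq_sum_single:
  fixes f g :: "'k::comm_monoid_add \<Rightarrow>\<^sub>0 'b::comm_ring_1"
  shows "f * g = (\<Sum>k\<in>Poly_Mapping.keys f. \<Sum>l\<in>Poly_Mapping.keys g.
    Poly_Mapping.single (k + l) (Poly_Mapping.lookup f k * Poly_Mapping.lookup g l))"
proof -
  have "f * g = (\<Sum>k\<in>Poly_Mapping.keys f. Poly_Mapping.single k (Poly_Mapping.lookup f k)) *
      (\<Sum>l\<in>Poly_Mapping.keys g. Poly_Mapping.single l (Poly_Mapping.lookup g l))"
    using poly_mapping_eq_sum_single[of f] poly_mapping_eq_sum_single[of g] by simp
  then show ?thesis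
    by (simp add: sum_product mult_single)
qed

text \<open>The hypothesis holds both for monomials at a point (\<open>mon_add\<close>) and for
  powers of \<open>t\<close> (\<open>power_add\<close>), so one argument makes evaluation and
  identification multiplicative.\<close>

lemma eval_along_mult:
  assumes "\<And>k l. \<phi> (k + l) = \<phi> k * \<phi> l"
  shows "eval_along \<phi> (f * g) = eval_along \<phi> f * eval_along \<phi> g"
proof -
  have "eval_along \<phi> (f * g) = (\<Sum>k\<in>Poly_Mapping.keys f. \<Sum>l\<in>Poly_Mapping.keys g.
      (Poly_Mapping.lookup f k * \<phi> k) * (Poly_Mapping.lookup g l * \<phi> l))"
    by (subst mult_eq_sum_single) (simp add: eval_along_sum assms mult_ac)
  then show ?thesis
    by (simp add: sum_product eval_along_def)
qed

section \<open>Monomials and total degree\<close>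

definition mon :: "(nat \<Rightarrow> real) \<Rightarrow> (nat \<Rightarrow>\<^sub>0 nat) \<Rightarrow> real" where
  "mon a u = (\<Prod>i\<in>Poly_Mapping.keys u. a i ^ Poly_Mapping.lookup u i)"

definition mdeg :: "(nat \<Rightarrow>\<^sub>0 nat) \<Rightarrow> nat" where
  "mdeg u = (\<Sum>i\<in>Poly_Mapping.keys u. Poly_Mapping.lookup u i)"

text \<open>Exponents in nat cannot cancel, hence an equality where \<open>keys_add\<close> gives
  only an inclusion.\<close>

lemma keys_add_nat: "Poly_Mapping.keys (u + v) = Poly_Mapping.keys u \<union> Poly_Mapping.keys (v :: nat \<Rightarrow>\<^sub>0 nat)"
  by (auto simp: in_keys_iff lookup_add)

text \<open>Exponent 0 contributes the factor 1. This puts monomials with different supports over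
  one index set, as \<open>mon_add\<close> requires.\<close>

lemma mon_superset:
  assumes "finite A" "Poly_Mapping.keys u \<subseteq> A"
  shows "mon a u = (\<Prod>i\<in>A. a i ^ Poly_Mapping.lookup u i)"
  unfolding mon_def using assms
  by (intro prod.mono_neutral_left) (auto simp: in_keys_iff)

lemma mon_add: "mon a (u + v) = mon a u * mon a v"
proof -
  let ?A = "Poly_Mapping.keys u \<union> Poly_Mapping.keys v"
  have "mon a w = (\<Prod>i\<in>?A. a i ^ Poly_Mapping.lookup w i)" if "Poly_Mapping.keys w \<subseteq> ?A" for w
    using that by (intro mon_superset) auto
  then show ?thesis
    by (simp add: keys_add_nat lookup_add power_add prod.distrib)
qed

lemma mdeg_add: "mdeg (u + v) = mdeg u + mdeg v"
  unfolding mdeg_def by (rule setsum_keys_plus_distrib) simp_all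

lemma abs_mon_le:
  assumes "\<And>i. i \<in> Poly_Mapping.keys u \<Longrightarrow> \<bar>a i\<bar> \<le> r"
  shows "\<bar>mon a u\<bar> \<le> r ^ mdeg u"
proof -
  have "\<bar>mon a u\<bar> = (\<Prod>i\<in>Poly_Mapping.keys u. \<bar>a i\<bar> ^ Poly_Mapping.lookup u i)"
    by (simp add: mon_def abs_prod power_abs)
  also have "\<dots> \<le> (\<Prod>i\<in>Poly_Mapping.keys u. r ^ Poly_Mapping.lookup u i)"
    using assms by (intro prod_mono) (auto intro: power_mono)
  also have "\<dots> = r ^ mdeg u"
    by (simp add: mdeg_def power_sum)
  finally show ?thesis .
qed

lemma total_degree_le_iff: "total_degree p \<le> k \<longleftrightarrow> (\<forall>u\<in>Poly_Mapping.keys p. mdeg u \<le> k)"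
  by (simp add: total_degree_def mdeg_def)

lemma total_degree_zero [simp]: "total_degree 0 = 0"
  by (simp add: total_degree_def)

lemma total_degree_const: "total_degree (mpoly_const c) \<le> k"
  by (simp add: total_degree_le_iff mpoly_const_def mdeg_def)

lemma total_degree_var: "total_degree (mpoly_var i) \<le> 1"
  by (simp add: total_degree_le_iff mpoly_var_def mdeg_def)

lemma total_degree_add:
  "total_degree p \<le> k \<Longrightarrow> total_degree q \<le> k \<Longrightarrow> total_degree (p + q) \<le> k"
  using keys_add[of p q] by (auto simp: total_degree_le_iff)

lemma total_degree_sum:
  "(\<And>x. x \<in> A \<Longrightarrow> total_degree (F x) \<le> k) \<Longrightarrow> total_degree (sum F A) \<le> k"
  by (induction A rule: infinite_finite_induct) (auto intro!: total_degree_add)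

lemma total_degree_mult:
  assumes "total_degree p \<le> k" "total_degree q \<le> l"
  shows "total_degree (p * q) \<le> k + l"
  using assms keys_mult[of p q] by (fastforce simp: total_degree_le_iff mdeg_add intro: add_mono)

lemma total_degree_power: "total_degree p \<le> k \<Longrightarrow> total_degree (p ^ d) \<le> k * d"
proof (induction d)
  case 0
  show ?case
    by (simp add: total_degree_def)
next
  case (Suc d)
  then show ?case
    using total_degree_mult[of p k "p ^ d" "k * d"] by simp
qed

section \<open>The polynomial rings \<open>mpolys m\<close>\<close>

lemma mpolys_const [intro]: "mpoly_const c \<in> mpolys m"
  by (simp add: mpolys_def mpoly_const_def)

lemma mpolys_var: "i < m \<Longrightarrow> mpoly_var i \<in> mpolys m"
  by (simp add: mpolys_def mpoly_var_def)

lemma single_in_mpolys: "Poly_Mapping.keys u \<subseteq> {..<m} \<Longrightarrow> Poly_Mapping.single u c \<in> mpolys m"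
  by (simp add: mpolys_def)

lemma mpolys_zero [simp]: "0 \<in> mpolys m"
  by (simp add: mpolys_def)

lemma mpolys_add: "p \<in> mpolys m \<Longrightarrow> q \<in> mpolys m \<Longrightarrow> p + q \<in> mpolys m"
  using keys_add[of p q] by (auto simp: mpolys_def)

lemma mpolys_sum: "(\<And>x. x \<in> A \<Longrightarrow> F x \<in> mpolys m) \<Longrightarrow> sum F A \<in> mpolys m"
  by (induction A rule: infinite_finite_induct) (auto intro: mpolys_add)

lemma mpolys_mult:
  assumes "p \<in> mpolys m" "q \<in> mpolys m"
  shows "p * q \<in> mpolys m"
  using assms keys_mult[of p q] by (fastforce simp: mpolys_def keys_add_nat)

lemma mpolys_power: "p \<in> mpolys m \<Longrightarrow> p ^ d \<in> mpolys m"
proof (induction d)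
  case 0
  show ?case
    by (simp add: mpolys_def)
next
  case (Suc d)
  then show ?case
    by (simp add: mpolys_mult)
qed

lemma mpolys_mono: "m \<le> m' \<Longrightarrow> p \<in> mpolys m \<Longrightarrow> p \<in> mpolys m'"
  by (force simp: mpolys_def)

lemma mpoly_eval_eq_eval_along: "mpoly_eval p a = eval_along (mon a) p"
  by (simp add: mpoly_eval_def eval_along_def mon_def)

lemma mpoly_eval_zero [simp]: "mpoly_eval 0 a = 0"
  by (simp add: mpoly_eval_def)

lemma mpoly_eval_add: "mpoly_eval (p + q) a = mpoly_eval p a + mpoly_eval q a"
  by (simp add: mpoly_eval_eq_eval_along eval_along_add)

lemma mpoly_eval_sum: "mpoly_eval (sum F A) a = (\<Sum>x\<in>A. mpoly_eval (F x) a)"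
  by (simp add: mpoly_eval_eq_eval_along eval_along_sum)

lemma mpoly_eval_mult: "mpoly_eval (p * q) a = mpoly_eval p a * mpoly_eval q a"
  by (simp add: mpoly_eval_eq_eval_along eval_along_mult mon_add)

lemma mpoly_eval_const [simp]: "mpoly_eval (mpoly_const c) a = c"
  by (simp add: mpoly_eval_def mpoly_const_def)

lemma mpoly_eval_var [simp]: "mpoly_eval (mpoly_var i) a = a i"
  by (simp add: mpoly_eval_def mpoly_var_def)

lemma mpoly_eval_power: "mpoly_eval (p ^ d) a = mpoly_eval p a ^ d"
proof (induction d)
  case 0
  show ?case
    by (simp add: mpoly_eval_def)
next
  case (Suc d)
  then show ?case
    by (simp add: mpoly_eval_mult)
qed

lemma mpoly_eval_fun_upd:
  assumes "p \<in> mpolys n"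
  shows "mpoly_eval p (a(n := s)) = mpoly_eval p a"
  unfolding mpoly_eval_eq_eval_along eval_along_def mon_def
  using assms by (intro sum.cong refl arg_cong2[where f = "(*)"] prod.cong) (auto simp: mpolys_def)

text \<open>The l1 norm of the coefficient vector; it serves as the constant in the growth estimates
  below.\<close>

definition coeff_norm :: "mpoly \<Rightarrow> real" where
  "coeff_norm p = (\<Sum>u\<in>Poly_Mapping.keys p. \<bar>Poly_Mapping.lookup p u\<bar>)"

lemma coeff_norm_nonneg: "0 \<le> coeff_norm p"
  by (simp add: coeff_norm_def sum_nonneg)

lemma abs_mpoly_eval_le:
  assumes "\<And>u. u \<in> Poly_Mapping.keys p \<Longrightarrow> \<bar>mon a u\<bar> \<le> b"
  shows "\<bar>mpoly_eval p a\<bar> \<le> coeff_norm p * b"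
proof -
  have "\<bar>mpoly_eval p a\<bar> \<le> (\<Sum>u\<in>Poly_Mapping.keys p. \<bar>Poly_Mapping.lookup p u * mon a u\<bar>)"
    unfolding mpoly_eval_eq_eval_along eval_along_def by (rule sum_abs)
  also have "\<dots> \<le> (\<Sum>u\<in>Poly_Mapping.keys p. \<bar>Poly_Mapping.lookup p u\<bar> * b)"
    using assms by (intro sum_mono) (auto simp: abs_mult intro: mult_left_mono)
  finally show ?thesis
    by (simp add: coeff_norm_def sum_distrib_right)
qed

lemma abs_le_L2_set:
  assumes "i \<in> A" "finite A"
  shows "\<bar>a i\<bar> \<le> L2_set a A"
proof -
  have "L2_set a {i} \<le> L2_set a A"
    unfolding L2_set_def using assms by (intro real_sqrt_le_mono sum_mono2) auto
  then show ?thesis by simp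
qed

text \<open>Each coordinate is at most the norm, so a monomial is at most the norm to its degree;
  since the norm is at least 1, that exponent may be raised to \<open>k\<close>.\<close>

lemma abs_mpoly_eval_le_power:
  assumes "p \<in> mpolys n" "total_degree p \<le> k" "1 \<le> L2_set a {..<n}"
  shows "\<bar>mpoly_eval p a\<bar> \<le> coeff_norm p * L2_set a {..<n} ^ k"
proof (rule abs_mpoly_eval_le)
  fix u assume u: "u \<in> Poly_Mapping.keys p"
  have "\<bar>mon a u\<bar> \<le> L2_set a {..<n} ^ mdeg u"
  proof (rule abs_mon_le)
    fix i assume "i \<in> Poly_Mapping.keys u"
    then show "\<bar>a i\<bar> \<le> L2_set a {..<n}"
      using assms(1) u by (intro abs_le_L2_set) (auto simp: mpolys_def)
  qed
  also have "\<dots> \<le> L2_set a {..<n} ^ k"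
    using assms u by (intro power_increasing) (auto simp: total_degree_le_iff)
  finally show "\<bar>mon a u\<bar> \<le> L2_set a {..<n} ^ k" .
qed

lemma abs_mpoly_eval_le_unit_ball:
  assumes "p \<in> mpolys n" "L2_set a {..<n} \<le> 1"
  shows "\<bar>mpoly_eval p a\<bar> \<le> coeff_norm p"
proof -
  have "\<bar>mon a u\<bar> \<le> 1" if u: "u \<in> Poly_Mapping.keys p" for u
  proof -
    have "\<bar>a i\<bar> \<le> 1" if "i \<in> Poly_Mapping.keys u" for i
    proof -
      have "i \<in> {..<n}"
        using assms(1) u that by (auto simp: mpolys_def)
      then show ?thesis
        using abs_le_L2_set[of i "{..<n}" a] assms(2) by simp
    qed
    then show ?thesis
      using abs_mon_le[of u a 1] by simp
  qed
  then show ?thesis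
    using abs_mpoly_eval_le[of p a 1] by simp
qed

section \<open>Bounded polynomials\<close>

text \<open>For \<open>d = 0\<close> the majorant \<open>q\<close> has at most a constant term, so
  \<open>sqrt (coeff_norm q)\<close> bounds p. Conversely the constant \<open>C\<^sup>2\<close> is a
  majorant.\<close>

lemma bdd_polys_0_iff:
  "p \<in> bdd_polys m 0 T \<longleftrightarrow> p \<in> mpolys m \<and> (\<exists>C. \<forall>a\<in>T. \<bar>mpoly_eval p a\<bar> \<le> C)"
proof (intro iffI conjI)
  assume "p \<in> bdd_polys m 0 T"
  then obtain q where p: "p \<in> mpolys m" and q: "total_degree q \<le> 0"
      and le: "\<And>a. a \<in> T \<Longrightarrow> (mpoly_eval p a)\<^sup>2 \<le> mpoly_eval q a"
    by (auto simp: bdd_polys_def)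
  show "p \<in> mpolys m"
    by (fact p)
  have "\<bar>mpoly_eval p a\<bar> \<le> sqrt (coeff_norm q)" if a: "a \<in> T" for a
  proof -
    have "\<bar>mpoly_eval q a\<bar> \<le> coeff_norm q * 1"
    proof (rule abs_mpoly_eval_le)
      fix u assume "u \<in> Poly_Mapping.keys q"
      then have "mdeg u = 0"
        using q total_degree_le_iff[of q 0] by simp
      then have "Poly_Mapping.keys u = {}"
        unfolding mdeg_def by (metis finite_keys sum_eq_0_iff in_keys_iff equals0I)
      then show "\<bar>mon a u\<bar> \<le> 1"
        by (simp add: mon_def)
    qed
    then have "(mpoly_eval p a)\<^sup>2 \<le> coeff_norm q"
      using le[OF a] by linarith
    then show ?thesis
      using real_sqrt_le_mono by fastforce
  qed
  then show "\<exists>C. \<forall>a\<in>T. \<bar>mpoly_eval p a\<bar> \<le> C"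
    by blast
next
  assume "p \<in> mpolys m \<and> (\<exists>C. \<forall>a\<in>T. \<bar>mpoly_eval p a\<bar> \<le> C)"
  then obtain C where p: "p \<in> mpolys m" and C: "\<And>a. a \<in> T \<Longrightarrow> \<bar>mpoly_eval p a\<bar> \<le> C"
    by blast
  have "(mpoly_eval p a)\<^sup>2 \<le> mpoly_eval (mpoly_const (C\<^sup>2)) a" if "a \<in> T" for a
    using power_mono[OF C[OF that], of 2] by simp
  then show "p \<in> bdd_polys m 0 T"
    using p total_degree_const[of "C\<^sup>2" 0] by (auto simp: bdd_polys_def)
qed

lemma real_subalgebra_bdd_polys_0: "real_subalgebra mpoly_const (bdd_polys m 0 T)"
  unfolding real_subalgebra_def
proof (intro conjI ballI)
  show "range mpoly_const \<subseteq> bdd_polys m 0 T"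
    by (auto simp: bdd_polys_0_iff)
next
  fix p q assume "p \<in> bdd_polys m 0 T" "q \<in> bdd_polys m 0 T"
  then obtain C D where pq: "p \<in> mpolys m" "q \<in> mpolys m"
    and C: "\<And>a. a \<in> T \<Longrightarrow> \<bar>mpoly_eval p a\<bar> \<le> C"
    and D: "\<And>a. a \<in> T \<Longrightarrow> \<bar>mpoly_eval q a\<bar> \<le> D"
    by (auto simp: bdd_polys_0_iff)
  have "\<bar>mpoly_eval (p + q) a\<bar> \<le> C + D" if "a \<in> T" for a
    using C[OF that] D[OF that] by (simp add: mpoly_eval_add)
  then show "p + q \<in> bdd_polys m 0 T"
    using pq by (auto simp: bdd_polys_0_iff mpolys_add)
  have "\<bar>mpoly_eval (p * q) a\<bar> \<le> C * D" if "a \<in> T" for a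
    using mult_mono'[OF C[OF that] D[OF that]] by (simp add: mpoly_eval_mult abs_mult)
  then show "p * q \<in> bdd_polys m 0 T"
    using pq by (auto simp: bdd_polys_0_iff mpolys_mult)
qed

section \<open>The identification\<close>

lemma mpoly_var_power: "mpoly_var n ^ d = Poly_Mapping.single (Poly_Mapping.single n d) 1"
  by (induction d) (simp_all add: mpoly_var_def mult_single flip: single_add)

lemma identification_eq_eval_along: "identification n = eval_along (\<lambda>d. mpoly_var n ^ d)"
  by (simp add: fun_eq_iff identification_def eval_along_def)

lemma identification_add: "identification n (f + g) = identification n f + identification n g"
  by (simp add: identification_eq_eval_along eval_along_add)

lemma identification_mult: "identification n (f * g) = identification n f * identification n g"
  by (simp add: identification_eq_eval_along eval_along_mult power_add)

lemma identification_single: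
  "identification n (Poly_Mapping.single d p) = p * mpoly_var n ^ d"
  by (simp add: identification_eq_eval_along)

text \<open>Over a fixed base point \<open>a\<close> the identified polynomial is univariate in
  \<open>s\<close>, which is what makes \<open>coeff_bound\<close> applicable.\<close>

lemma mpoly_eval_identification:
  assumes "\<And>d. Poly_Mapping.lookup f d \<in> mpolys n"
  shows "mpoly_eval (identification n f) (a(n := s)) =
    (\<Sum>d\<in>Poly_Mapping.keys f. mpoly_eval (Poly_Mapping.lookup f d) a * s ^ d)"
  using assms
  by (simp add: identification_def mpoly_eval_sum mpoly_eval_mult mpoly_eval_power
      mpoly_eval_fun_upd)

text \<open>The full domain of the identification: coefficients free of \<open>t\<close>, without
  which the sum of the p_d t^d would not determine the p_d. Membership in the graded algebra is
  later cut out of this ring by a boundedness condition.\<close>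

definition graded_mpolys :: "nat \<Rightarrow> (nat \<Rightarrow>\<^sub>0 mpoly) set" where
  "graded_mpolys n = {f. \<forall>d. Poly_Mapping.lookup f d \<in> mpolys n}"

lemma graded_mpolys_add:
  "f \<in> graded_mpolys n \<Longrightarrow> g \<in> graded_mpolys n \<Longrightarrow> f + g \<in> graded_mpolys n"
  by (simp add: graded_mpolys_def lookup_add mpolys_add)

lemma graded_mpolys_mult:
  assumes "f \<in> graded_mpolys n" "g \<in> graded_mpolys n"
  shows "f * g \<in> graded_mpolys n"
proof -
  have "Poly_Mapping.lookup (f * g) d \<in> mpolys n" for d
    using assms
    by (subst mult_eq_sum_single)
       (auto simp: lookup_sum lookup_single when_def graded_mpolys_def
         intro!: mpolys_sum mpolys_mult)
  then show ?thesis
    by (simp add: graded_mpolys_def)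
qed

text \<open>Neither \<open>p\<close> nor \<open>u\<close> involves the variable \<open>n\<close>, so
  the exponent of \<open>n\<close> forces \<open>e = d\<close>, and cancelling it leaves the
  exponent vector \<open>u\<close>.\<close>

lemma lookup_mult_var_power:
  assumes "p \<in> mpolys n" "Poly_Mapping.keys u \<subseteq> {..<n}"
  shows "Poly_Mapping.lookup (p * mpoly_var n ^ e) (u + Poly_Mapping.single n d) =
    (Poly_Mapping.lookup p u when e = d)"
proof -
  have eq: "v + Poly_Mapping.single n e = u + Poly_Mapping.single n d \<longleftrightarrow> v = u \<and> e = d"
    if "v \<in> Poly_Mapping.keys p" for v
  proof
    assume eq: "v + Poly_Mapping.single n e = u + Poly_Mapping.single n d"
    have "n \<notin> Poly_Mapping.keys v" "n \<notin> Poly_Mapping.keys u"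
      using assms that by (auto simp: mpolys_def)
    then have "e = d"
      using arg_cong[OF eq, of "\<lambda>w. Poly_Mapping.lookup w n"]
      by (simp add: lookup_add in_keys_iff)
    then show "v = u \<and> e = d"
      using eq by simp
  qed simp
  have "Poly_Mapping.lookup (p * mpoly_var n ^ e) (u + Poly_Mapping.single n d) =
      (\<Sum>v\<in>Poly_Mapping.keys p.
        (Poly_Mapping.lookup p v when v + Poly_Mapping.single n e = u + Poly_Mapping.single n d))"
    by (subst mult_eq_sum_single) (simp add: mpoly_var_power lookup_sum lookup_single)
  also have "\<dots> = (\<Sum>v\<in>Poly_Mapping.keys p. if v = u then (Poly_Mapping.lookup p u when e = d) else 0)"
    by (intro sum.cong refl) (auto simp: eq when_def)
  also have "\<dots> = (Poly_Mapping.lookup p u when e = d)"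
    by (simp add: when_def in_keys_iff)
  finally show ?thesis .
qed

text \<open>Every coefficient of every p_d can be read off from the identified polynomial;
  injectivity follows.\<close>

lemma lookup_identification:
  assumes "f \<in> graded_mpolys n" "Poly_Mapping.keys u \<subseteq> {..<n}"
  shows "Poly_Mapping.lookup (identification n f) (u + Poly_Mapping.single n d) =
    Poly_Mapping.lookup (Poly_Mapping.lookup f d) u"
proof -
  have "Poly_Mapping.lookup (identification n f) (u + Poly_Mapping.single n d) =
      (\<Sum>e\<in>Poly_Mapping.keys f. (Poly_Mapping.lookup (Poly_Mapping.lookup f e) u when e = d))"
    using assms by (simp add: identification_def lookup_sum lookup_mult_var_power graded_mpolys_def)
  also have "\<dots> = Poly_Mapping.lookup (Poly_Mapping.lookup f d) u"
    by (auto simp: when_def in_keys_iff)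
  finally show ?thesis .
qed

lemma inj_on_identification: "inj_on (identification n) (graded_mpolys n)"
proof (rule inj_onI)
  fix f g assume fg: "f \<in> graded_mpolys n" "g \<in> graded_mpolys n"
    and eq: "identification n f = identification n g"
  have "Poly_Mapping.lookup (Poly_Mapping.lookup f d) u = Poly_Mapping.lookup (Poly_Mapping.lookup g d) u"
    for d u
  proof (cases "Poly_Mapping.keys u \<subseteq> {..<n}")
    case True
    then show ?thesis
      using fg eq by (metis lookup_identification)
  next
    \<comment> \<open>Exponent vectors involving \<open>n\<close> or a later variable have
      coefficient 0 on both sides.\<close>
    case False
    then have "u \<notin> Poly_Mapping.keys (Poly_Mapping.lookup f d)"
        "u \<notin> Poly_Mapping.keys (Poly_Mapping.lookup g d)"
      using fg unfolding graded_mpolys_def mpolys_def by blast+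
    then show ?thesis
      by (simp add: in_keys_iff)
  qed
  then show "f = g"
    by (intro poly_mapping_eqI)
qed

lemma identification_surj:
  assumes "P \<in> mpolys (Suc n)"
  obtains f where "f \<in> graded_mpolys n" "identification n f = P"
proof
  \<comment> \<open>\<open>r w\<close> strips the power of \<open>t\<close> from the monomial
    \<open>w\<close>; \<open>f\<close> then collects the terms of \<open>P\<close> by their exponent
    of \<open>t\<close>.\<close>
  define r where "r w = Poly_Mapping.update n 0 w" for w :: "nat \<Rightarrow>\<^sub>0 nat"
  define f where "f = (\<Sum>w\<in>Poly_Mapping.keys P. Poly_Mapping.single (Poly_Mapping.lookup w n)
      (Poly_Mapping.single (r w) (Poly_Mapping.lookup P w)))"
  have "Poly_Mapping.keys (r w) \<subseteq> {..<n}" if "w \<in> Poly_Mapping.keys P" for w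
    using assms that by (force simp: r_def keys_update mpolys_def less_Suc_eq)
  then show "f \<in> graded_mpolys n"
    by (auto simp: graded_mpolys_def f_def lookup_sum lookup_single when_def single_in_mpolys
        intro!: mpolys_sum)
  have split: "r w + Poly_Mapping.single n (Poly_Mapping.lookup w n) = w" for w
    by (intro poly_mapping_eqI)
       (simp add: r_def lookup_add lookup_update lookup_single when_def)
  have "identification n f = (\<Sum>w\<in>Poly_Mapping.keys P. Poly_Mapping.single w (Poly_Mapping.lookup P w))"
    by (simp add: f_def identification_eq_eval_along eval_along_sum mpoly_var_power mult_single split)
  then show "identification n f = P"
    using poly_mapping_eq_sum_single[of P] by simp
qed

section \<open>Coefficient bounds for univariate polynomials\<close>

text \<open>The induction eliminates the leading term by passing from \<open>f(v)\<close> to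
  \<open>2 ^ D f(v / 2) - f(v)\<close>.\<close>

lemma coeff_bound:
  "\<exists>K. \<forall>c C. (\<forall>v::real. \<bar>v\<bar> \<le> 1 \<longrightarrow> \<bar>\<Sum>i\<le>D. c i * v ^ i\<bar> \<le> C) \<longrightarrow> (\<forall>i\<le>D. \<bar>c i\<bar> \<le> K * C)"
proof (induction D)
  case 0
  show ?case
    by (rule exI[of _ 1]) (simp, metis abs_zero zero_le_one)
next
  case (Suc D)
  then obtain K where K: "\<And>(c :: nat \<Rightarrow> real) C i.
      (\<And>v. \<bar>v\<bar> \<le> 1 \<Longrightarrow> \<bar>\<Sum>i\<le>D. c i * v ^ i\<bar> \<le> C) \<Longrightarrow> i \<le> D \<Longrightarrow> \<bar>c i\<bar> \<le> K * C"
    by metis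
  \<comment> \<open>\<open>K\<close> will be applied to a polynomial with coefficients
    \<open>b\<close> that is bounded by \<open>(2 ^ Suc D + 1) * C\<close> on [-1, 1].\<close>
  define M where "M = K * (2 ^ Suc D + 1)"
  have "\<bar>c i\<bar> \<le> max M (1 + real (Suc D) * M) * C"
    if bound: "\<And>v. \<bar>v\<bar> \<le> 1 \<Longrightarrow> \<bar>\<Sum>i\<le>Suc D. c i * v ^ i\<bar> \<le> C" and "i \<le> Suc D"
    for c :: "nat \<Rightarrow> real" and C i
  proof -
    let ?f = "\<lambda>v. \<Sum>i\<le>Suc D. c i * v ^ i"
    have C: "0 \<le> C"
      using bound[of 0] by linarith
    \<comment> \<open>The factor vanishes at \<open>i = Suc D\<close>, removing the leading term,
      and is at least 1 for \<open>i \<le> D\<close>, so bounds on \<open>b i\<close> pass to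
      \<open>c i\<close>.\<close>
    define b where "b i = c i * (2 ^ (Suc D - i) - 1)" for i
    have b: "(\<Sum>i\<le>D. b i * v ^ i) = 2 ^ Suc D * ?f (v / 2) - ?f v" for v
    proof -
      have "2 ^ Suc D * (c i * (v / 2) ^ i) - c i * v ^ i = b i * v ^ i" if "i \<le> Suc D" for i
      proof -
        have "(2 :: real) ^ Suc D = 2 ^ (Suc D - i) * 2 ^ i"
          using that by (simp flip: power_add)
        then show ?thesis
          by (simp add: b_def power_divide algebra_simps)
      qed
      then have "2 ^ Suc D * ?f (v / 2) - ?f v = (\<Sum>i\<le>Suc D. b i * v ^ i)"
        by (simp only: sum_distrib_left flip: sum_subtractf) (auto intro!: sum.cong)
      also have "\<dots> = (\<Sum>i\<le>D. b i * v ^ i)"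
        by (simp add: b_def)
      finally show ?thesis by simp
    qed
    have small: "\<bar>c i\<bar> \<le> M * C" if i: "i \<le> D" for i
    proof -
      have "\<bar>\<Sum>i\<le>D. b i * v ^ i\<bar> \<le> (2 ^ Suc D + 1) * C" if v: "\<bar>v\<bar> \<le> 1" for v
      proof -
        have "\<bar>2 ^ Suc D * ?f (v / 2) - ?f v\<bar> \<le> \<bar>2 ^ Suc D * ?f (v / 2)\<bar> + \<bar>?f v\<bar>"
          by (rule abs_triangle_ineq4)
        also have "\<bar>2 ^ Suc D * ?f (v / 2)\<bar> = 2 ^ Suc D * \<bar>?f (v / 2)\<bar>"
          by (simp add: abs_mult)
        also have "2 ^ Suc D * \<bar>?f (v / 2)\<bar> + \<bar>?f v\<bar> \<le> 2 ^ Suc D * C + C"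
          using v by (intro add_mono mult_left_mono bound) auto
        finally show ?thesis
          unfolding b by (simp add: algebra_simps)
      qed
      from K[OF this i] have "\<bar>b i\<bar> \<le> M * C"
        by (simp add: M_def mult.assoc)
      moreover have "\<bar>c i\<bar> * 1 \<le> \<bar>b i\<bar>"
      proof -
        have "(2::real) ^ 1 \<le> 2 ^ (Suc D - i)"
          using i by (intro power_increasing) auto
        then show ?thesis
          unfolding b_def abs_mult by (intro mult_left_mono) auto
      qed
      ultimately show ?thesis by simp
    qed
    \<comment> \<open>The leading coefficient is the value at 1 minus the lower coefficients, which
      are already bounded.\<close>
    have top: "\<bar>c (Suc D)\<bar> \<le> (1 + real (Suc D) * M) * C"
    proof -
      have "c (Suc D) = ?f 1 - (\<Sum>i\<le>D. c i)"
        by simp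
      moreover have "\<bar>?f 1\<bar> \<le> C"
        by (rule bound) simp
      moreover have "\<bar>\<Sum>i\<le>D. c i\<bar> \<le> (\<Sum>i\<le>D. M * C)"
        by (rule order_trans[OF sum_abs sum_mono]) (simp add: small)
      ultimately show ?thesis
        by (simp add: algebra_simps)
    qed
    show ?thesis
    proof (cases "i = Suc D")
      case True
      have "(1 + real (Suc D) * M) * C \<le> max M (1 + real (Suc D) * M) * C"
        using C by (intro mult_right_mono) simp_all
      with top True show ?thesis by simp
    next
      case False
      then have "\<bar>c i\<bar> \<le> M * C"
        using \<open>i \<le> Suc D\<close> by (intro small) simp
      also have "M * C \<le> max M (1 + real (Suc D) * M) * C"
        using C by (intro mult_right_mono) simp_all
      finally show ?thesis .
    qed
  qed
  then show ?case
    by (intro exI[of _ "max M (1 + real (Suc D) * M)"]) blast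
qed

section \<open>Bounded polynomials on the cusp set\<close>

text \<open>The square of p t^d is at most q(a) s^(2d). Here q(a) grows at most like the norm to the
  power 2d, which s^(2d) compensates because norm times |s| is at most 1.\<close>

lemma identification_single_bounded:
  assumes "p \<in> bdd_polys n d S"
  shows "p * mpoly_var n ^ d \<in> bdd_polys (Suc n) 0 (cusp_set n S)"
proof -
  obtain q where p: "p \<in> mpolys n" and q: "q \<in> mpolys n" "total_degree q \<le> 2 * d"
    and le: "\<And>a. a \<in> S \<Longrightarrow> (mpoly_eval p a)\<^sup>2 \<le> mpoly_eval q a"
    using assms by (auto simp: bdd_polys_def)
  have "\<bar>mpoly_eval (p * mpoly_var n ^ d) (a(n := s))\<bar> \<le> sqrt (coeff_norm q)"
    if a: "a \<in> S" "1 \<le> L2_set a {..<n}" and s: "(L2_set a {..<n})\<^sup>2 * s\<^sup>2 \<le> 1" for a s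
  proof -
    let ?r = "L2_set a {..<n}"
    have "(mpoly_eval (p * mpoly_var n ^ d) (a(n := s)))\<^sup>2 = (mpoly_eval p a)\<^sup>2 * s ^ (2 * d)"
      using p by (simp add: mpoly_eval_mult mpoly_eval_power mpoly_eval_fun_upd power_mult_distrib
          mult.commute flip: power_mult)
    also have "\<dots> \<le> (coeff_norm q * ?r ^ (2 * d)) * s ^ (2 * d)"
      using le[OF a(1)] abs_mpoly_eval_le_power[OF q a(2)] by (intro mult_right_mono) auto
    also have "\<dots> = coeff_norm q * (?r\<^sup>2 * s\<^sup>2) ^ d"
      by (simp add: power_mult power_mult_distrib)
    also have "\<dots> \<le> coeff_norm q * 1"
      using s by (intro mult_left_mono power_le_one coeff_norm_nonneg) auto
    finally show ?thesis
      using real_sqrt_le_mono by fastforce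
  qed
  then have "\<exists>C. \<forall>b\<in>cusp_set n S. \<bar>mpoly_eval (p * mpoly_var n ^ d) b\<bar> \<le> C"
    unfolding cusp_set_def by blast
  moreover have "p * mpoly_var n ^ d \<in> mpolys (Suc n)"
    using p by (auto intro!: mpolys_mult mpolys_power mpolys_var intro: mpolys_mono[of n])
  ultimately show ?thesis
    by (simp add: bdd_polys_0_iff)
qed

text \<open>Growth is only known where the norm is at least 1; elsewhere \<open>coeff_norm p\<close>
  bounds p. Adding the two squared bounds gives one majorant for all of S, as both summands are
  nonnegative.\<close>

lemma bdd_polys_if_growth:
  assumes p: "p \<in> mpolys n"
    and C: "\<And>a. a \<in> S \<Longrightarrow> 1 \<le> L2_set a {..<n} \<Longrightarrow> \<bar>mpoly_eval p a\<bar> \<le> C * L2_set a {..<n} ^ d"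
  shows "p \<in> bdd_polys n d S"
proof -
  \<comment> \<open>The sum of squares to the power \<open>d\<close> evaluates to the norm to the
    power \<open>2 * d\<close>, keeping the majorant polynomial of admissible degree.\<close>
  define q where "q = mpoly_const (C\<^sup>2) * (\<Sum>i<n. mpoly_var i ^ 2) ^ d + mpoly_const ((coeff_norm p)\<^sup>2)"
  have q_eval: "mpoly_eval q a = C\<^sup>2 * (L2_set a {..<n} ^ d)\<^sup>2 + (coeff_norm p)\<^sup>2" for a
    by (simp add: q_def mpoly_eval_add mpoly_eval_mult mpoly_eval_power mpoly_eval_sum L2_set_def
        sum_nonneg power2_eq_square flip: power_mult_distrib)
  have "q \<in> mpolys n"
    unfolding q_def
    by (intro mpolys_add mpolys_mult mpolys_power mpolys_sum mpolys_const mpolys_var) simp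
  moreover have "total_degree q \<le> 2 * d"
  proof -
    have "total_degree (mpoly_var i ^ 2) \<le> 2" for i
      using total_degree_power[OF total_degree_var, of i 2] by simp
    then have "total_degree ((\<Sum>i<n. mpoly_var i ^ 2) ^ d) \<le> 2 * d"
      by (intro total_degree_power total_degree_sum)
    from total_degree_mult[OF total_degree_const[of "C\<^sup>2" 0] this] show ?thesis
      unfolding q_def by (intro total_degree_add total_degree_const) simp
  qed
  moreover have "(mpoly_eval p a)\<^sup>2 \<le> mpoly_eval q a" if a: "a \<in> S" for a
  proof (cases "1 \<le> L2_set a {..<n}")
    case True
    have "(mpoly_eval p a)\<^sup>2 \<le> (C * L2_set a {..<n} ^ d)\<^sup>2"
      using power_mono[OF C[OF a True], of 2] by simp
    then show ?thesis
      by (simp add: q_eval power_mult_distrib add_increasing2)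
  next
    case False
    then have "\<bar>mpoly_eval p a\<bar> \<le> coeff_norm p"
      using p by (intro abs_mpoly_eval_le_unit_ball) auto
    from power_mono[OF this, of 2] show ?thesis
      by (simp add: q_eval add_increasing)
  qed
  ultimately show ?thesis
    using p by (auto simp: bdd_polys_def)
qed

lemma graded_bdd_if_identification_bounded:
  assumes f: "f \<in> graded_mpolys n"
    and "identification n f \<in> bdd_polys (Suc n) 0 (cusp_set n S)"
  shows "Poly_Mapping.lookup f d \<in> bdd_polys n d S"
proof -
  obtain C where C: "\<And>b. b \<in> cusp_set n S \<Longrightarrow> \<bar>mpoly_eval (identification n f) b\<bar> \<le> C"
    using assms(2) by (auto simp: bdd_polys_0_iff)
  \<comment> \<open>Inserting \<open>d\<close> covers a component that is 0 and thus not among the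
    keys, and keeps the maximum well defined for \<open>f = 0\<close>.\<close>
  define D where "D = Max (insert d (Poly_Mapping.keys f))"
  have D: "d \<le> D" "Poly_Mapping.keys f \<subseteq> {..D}"
    by (auto simp: D_def)
  obtain K where K: "\<And>(c :: nat \<Rightarrow> real) C i.
      (\<And>v. \<bar>v\<bar> \<le> 1 \<Longrightarrow> \<bar>\<Sum>i\<le>D. c i * v ^ i\<bar> \<le> C) \<Longrightarrow> i \<le> D \<Longrightarrow> \<bar>c i\<bar> \<le> K * C"
    using coeff_bound[of D] by metis
  show ?thesis
  proof (rule bdd_polys_if_growth)
    show "Poly_Mapping.lookup f d \<in> mpolys n"
      using f by (simp add: graded_mpolys_def)
  next
    fix a assume a: "a \<in> S" "1 \<le> L2_set a {..<n}"
    let ?r = "L2_set a {..<n}"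
    \<comment> \<open>These are the coefficients in \<open>v\<close> after substituting s = v /
      norm; the interval [-1, 1] for \<open>v\<close> corresponds to the whole fibre of the cusp set
      over \<open>a\<close>.\<close>
    let ?c = "\<lambda>i. mpoly_eval (Poly_Mapping.lookup f i) a / ?r ^ i"
    have "\<bar>\<Sum>i\<le>D. ?c i * v ^ i\<bar> \<le> C" if v: "\<bar>v\<bar> \<le> 1" for v
    proof -
      have "?r\<^sup>2 * (v / ?r)\<^sup>2 \<le> 1"
        using a(2) v by (simp add: power_divide abs_square_le_1)
      then have "a(n := v / ?r) \<in> cusp_set n S"
        using a unfolding cusp_set_def by blast
      moreover have "mpoly_eval (identification n f) (a(n := v / ?r)) = (\<Sum>i\<le>D. ?c i * v ^ i)"
      proof -
        have "mpoly_eval (identification n f) (a(n := v / ?r)) =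
            (\<Sum>i\<in>Poly_Mapping.keys f. ?c i * v ^ i)"
          using f by (simp add: mpoly_eval_identification graded_mpolys_def power_divide)
        also have "\<dots> = (\<Sum>i\<le>D. ?c i * v ^ i)"
          using D(2) by (intro sum.mono_neutral_left) (auto simp: in_keys_iff)
        finally show ?thesis .
      qed
      ultimately show ?thesis
        using C by fastforce
    qed
    \<comment> \<open>Both \<open>K\<close> and \<open>C\<close> were chosen before
      \<open>a\<close>, so the growth constant \<open>K * C\<close> is uniform on S.\<close>
    from K[OF this D(1)]
    show "\<bar>mpoly_eval (Poly_Mapping.lookup f d) a\<bar> \<le> (K * C) * ?r ^ d"
      using a(2) by (simp add: abs_divide pos_divide_le_eq)
  qed
qed

text \<open>Describing the graded algebra as a preimage lets its closure under products be inherited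
  from the bounded polynomials, with no majorants to multiply.\<close>

lemma graded_bdd_polys_eq:
  "graded_bdd_polys n S =
    {f \<in> graded_mpolys n. identification n f \<in> bdd_polys (Suc n) 0 (cusp_set n S)}"
proof (intro equalityI subsetI CollectI conjI)
  fix f assume f: "f \<in> graded_bdd_polys n S"
  then show "f \<in> graded_mpolys n"
    by (auto simp: graded_bdd_polys_def graded_mpolys_def bdd_polys_def)
  let ?B = "bdd_polys (Suc n) 0 (cusp_set n S)"
  have "0 \<in> ?B"
    by (auto simp: bdd_polys_0_iff)
  moreover have "x + y \<in> ?B" if "x \<in> ?B" "y \<in> ?B" for x y
    using real_subalgebra_bdd_polys_0 that by (auto simp: real_subalgebra_def)
  ultimately have sum: "sum F A \<in> ?B" if "\<And>x. x \<in> A \<Longrightarrow> F x \<in> ?B" for F and A :: "nat set"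
    using that by (induction A rule: infinite_finite_induct) auto
  show "identification n f \<in> ?B"
    unfolding identification_def using f
    by (intro sum identification_single_bounded) (simp add: graded_bdd_polys_def)
next
  fix f assume "f \<in> {f \<in> graded_mpolys n. identification n f \<in> bdd_polys (Suc n) 0 (cusp_set n S)}"
  then show "f \<in> graded_bdd_polys n S"
    by (auto simp: graded_bdd_polys_def intro: graded_bdd_if_identification_bounded)
qed

theorem proposition5p1:
  fixes n :: nat and S :: "(nat \<Rightarrow> real) set"
  assumes "S \<subseteq> topspace (Euclidean_space n)"
  shows "real_algebra_iso graded_const (graded_bdd_polys n S)
           mpoly_const (bdd_polys (Suc n) 0 (cusp_set n S)) (identification n)
    \<and> (\<forall>d. \<forall>p\<in>bdd_polys n d S.
         identification n (Poly_Mapping.single d p) = p * mpoly_var n ^ d)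
    \<and> identification n ` graded_bdd_polys n S = bdd_polys (Suc n) 0 (cusp_set n S)"
proof -
  let ?A = "graded_bdd_polys n S" and ?B = "bdd_polys (Suc n) 0 (cusp_set n S)"
  note B = real_subalgebra_bdd_polys_0[of "Suc n" "cusp_set n S", unfolded real_subalgebra_def]
  have const: "identification n (graded_const c) = mpoly_const c" for c
    by (simp add: graded_const_def identification_single)
  have image: "identification n ` ?A = ?B"
  proof (intro equalityI subsetI)
    \<comment> \<open>A preimage among all graded families exists by sorting \<open>P\<close> by
      powers of \<open>t\<close>; boundedness of \<open>P\<close> then places it in the graded
      algebra.\<close>
    fix P assume P: "P \<in> ?B"
    then obtain f where "f \<in> graded_mpolys n" "identification n f = P"
      by (metis identification_surj bdd_polys_0_iff)
    with P show "P \<in> identification n ` ?A"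
      by (auto simp: graded_bdd_polys_eq)
  qed (auto simp: graded_bdd_polys_eq)
  have "inj_on (identification n) ?A"
    by (rule inj_on_subset[OF inj_on_identification]) (auto simp: graded_bdd_polys_eq)
  moreover have "graded_const c \<in> graded_mpolys n" for c
    by (auto simp: graded_const_def graded_mpolys_def lookup_single when_def)
  \<comment> \<open>The identification respects constants, sums and products, so the subalgebra
    property pulls back along it.\<close>
  then have "real_subalgebra graded_const ?A"
    using B unfolding real_subalgebra_def graded_bdd_polys_eq
    by (auto simp: const identification_add identification_mult graded_mpolys_add graded_mpolys_mult)
  ultimately have "real_algebra_iso graded_const ?A mpoly_const ?B (identification n)"
    unfolding real_algebra_iso_def
    using image by (simp add: real_subalgebra_bdd_polys_0 bij_betw_def const identification_add identification_mult)
  then show ?thesis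
    using image identification_single by blast
qed

end
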